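(* Let $X, X_1, X_2,\ldots$ be independent and identically distributed real-valued random variables on a probability space $(\Omega,\mathcal{A},\mathbb{P})$ with common cumulative distribution function $F$, let $uep(F)=\sup\{x\in\mathbb{R} : F(x)<1\}$ denote the upper endpoint of $F$, and let $U(1),U(2),\ldots$ be the associated record times. Then, for any $n\geq 1$ such that $U(n)$ is (almost surely) finite, $$\mathbb{P}(U(n+1)=+\infty)=\mathbb{P}(X=uep(F)).$$ As a consequence, the sequence of record values (and of record times) is almost surely finite if and only if $uep(F)$ is finite and is an atom of $F$, that is, $\mathbb{P}(X=uep(F))>0$.
   Context: Record times (strong upper records): $U(1)=1$, with record value $Y^{(1)}=X_1$. If $U(n)$ is defined and finite, put $Y^{(n)}=X_{U(n)}$ and $U(n+1)=\inf\{j>U(n) : X_j>Y^{(n)}\}$. If there is no such $j$, then $U(n+1)=+\infty$ (there is no further record value after the $n$-th one), and no later record times are defined; the sequence of records is then finite. Here $F(x)=\mathbb{P}(X\leq x)$. If $uep(F)=+\infty$, then $\mathbb{P}(X=uep(F))=0$. *)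

theory Defs
  imports "HOL-Probability.Probability"
begin

definition uep :: "(real \<Rightarrow> real) \<Rightarrow> ereal" where
  "uep F = Sup (ereal ` {x. F x < 1})"

text \<open>
  Sequences are indexed from 1; the entry \<open>x 0\<close> is never used.
  The value \<open>None\<close> means that the record time is not defined (in particular, for index 0 and
  for every index after the first infinite record time), whereas \<open>Some \<infinity>\<close> means that it is
  defined and equal to \<open>+\<infinity>\<close>. The infimum of the empty set in \<^typ>\<open>enat\<close> is \<open>\<infinity>\<close>.
  In the recursive clause, \<open>x k\<close> is the current record value.
\<close>

fun record_time :: "(nat \<Rightarrow> real) \<Rightarrow> nat \<Rightarrow> enat option" where
  "record_time x 0 = None"
| "record_time x (Suc 0) = Some 1"
| "record_time x (Suc (Suc n)) =
     (case record_time x (Suc n) of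
        None \<Rightarrow> None
      | Some u \<Rightarrow>
          (case u of
             enat k \<Rightarrow> Some (Inf (enat ` {j. j > k \<and> x j > x k}))
           | \<infinity> \<Rightarrow> None))"

definition record_value :: "(nat \<Rightarrow> real) \<Rightarrow> nat \<Rightarrow> real option" where
  "record_value x n =
     (case record_time x n of
        None \<Rightarrow> None
      | Some u \<Rightarrow> (case u of enat k \<Rightarrow> Some (x k) | \<infinity> \<Rightarrow> None))"

end

theory Submission
  imports Defs
begin

text \<open>
  Almost surely every \<open>X\<^sub>i\<close> is at most \<open>uep F\<close>, and every level below \<open>uep F\<close> is exceeded
  infinitely often. Hence a record value is the last one exactly when it equals \<open>uep F\<close>. If
  \<open>uep F\<close> is not an atom, almost surely no \<open>X\<^sub>i\<close> attains it and all record times are finite; if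
  it is an atom, almost surely some \<open>X\<^sub>i\<close> attains it and the sequence of records stops. In the
  latter case already \<open>U(2)\<close> is infinite with positive probability (namely when \<open>X\<^sub>1\<close> equals
  \<open>uep F\<close>), so for \<open>n \<ge> 2\<close> an almost surely finite \<open>U(n)\<close> forces \<open>P(X = uep F) = 0\<close>.
\<close>

section \<open>Record times of a deterministic sequence\<close>

lemma Inf_enat_image_mem:
  assumes "S \<noteq> {}"
  obtains k where "k \<in> S" "Inf (enat ` S) = enat k"
proof -
  obtain i where "i \<in> S" using assms by blast
  then have "Inf (enat ` S) \<in> enat ` S" by (intro wellorder_InfI[of "enat i"]) simp
  then show ?thesis using that by blast
qed

text \<open>The infimum of the empty set is infinite, so a finite value is attained by some later
  larger entry. This inverts the recursive clause and drives the inductions below.\<close>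

lemma record_time_Suc_enatD:
  assumes "record_time x (Suc (Suc n)) = Some (enat k)"
  obtains l where "record_time x (Suc n) = Some (enat l)" "l < k" "x l < x k"
    "\<And>j. l < j \<Longrightarrow> x l < x j \<Longrightarrow> k \<le> j"
proof -
  from assms obtain l where l: "record_time x (Suc n) = Some (enat l)"
    and k: "enat k = Inf (enat ` {j. j > l \<and> x j > x l})"
    by (auto split: option.splits enat.splits)
  let ?S = "{j. j > l \<and> x j > x l}"
  have "?S \<noteq> {}"
  proof
    assume "?S = {}"
    then have "enat k = Inf (enat ` {})" using k by metis
    then show False by (simp add: top_enat_def)
  qed
  then have "k \<in> ?S" using k Inf_enat_image_mem by (metis enat.inject)
  moreover have "k \<le> j" if "l < j" "x l < x j" for j
  proof -
    have "enat k \<le> enat j" unfolding k by (rule Inf_lower) (use that in auto)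
    then show ?thesis by simp
  qed
  ultimately show ?thesis using that l by auto
qed

lemma record_time_ge_index: "record_time x n = Some (enat k) \<Longrightarrow> n \<le> k"
proof (induction n arbitrary: k)
  case (Suc n)
  show ?case
  proof (cases n)
    case 0
    then show ?thesis using Suc.prems by (simp add: one_enat_def)
  next
    case (Suc m)
    then show ?thesis using Suc.IH Suc.prems
      by (metis record_time_Suc_enatD Suc_leI order.strict_trans1)
  qed
qed simp

text \<open>At each stage the infimum runs over a nonempty set, so it stays finite. This serves the
  case without an atom.\<close>

lemma record_time_finite:
  assumes "\<And>i. i \<ge> 1 \<Longrightarrow> \<exists>j>i. x i < x j"
  shows "\<exists>k\<ge>1. record_time x (Suc n) = Some (enat k)"
proof (induction n)
  case (Suc n)
  then obtain k where k: "k \<ge> 1" "record_time x (Suc n) = Some (enat k)" by blast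
  have "{j. j > k \<and> x j > x k} \<noteq> {}"
    using assms[OF k(1)] by auto
  then obtain j where "j > k" "Inf (enat ` {j. j > k \<and> x j > x k}) = enat j"
    using Inf_enat_image_mem by (metis (mono_tags, lifting) mem_Collect_eq)
  then show ?case using k by (intro exI[of _ j]) simp
qed (simp add: one_enat_def)

text \<open>Record times cannot jump over the position \<open>i\<close> of a maximum: a record time
  \<open>l\<close> with a finite successor has \<open>x l < x i\<close>, so \<open>l < i\<close> by
  induction, and \<open>i\<close> itself is a candidate for the next record time.\<close>

lemma record_time_le_argmax:
  assumes "i \<ge> 1" and max: "\<And>j. j \<ge> 1 \<Longrightarrow> x j \<le> x i"
  shows "record_time x n = Some (enat k) \<Longrightarrow> k \<le> i"
proof (induction n arbitrary: k)
  case (Suc n)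
  show ?case
  proof (cases n)
    case 0
    then show ?thesis using Suc.prems \<open>i \<ge> 1\<close> by (simp add: one_enat_def)
  next
    case (Suc m)
    then obtain l where l: "record_time x n = Some (enat l)" "l < k" "x l < x k"
      "\<And>j. l < j \<Longrightarrow> x l < x j \<Longrightarrow> k \<le> j"
      using Suc.prems by (metis record_time_Suc_enatD)
    have "x l < x i" using l(2,3) max[of k] by linarith
    moreover have "l \<le> i" using Suc.IH l(1) .
    ultimately show ?thesis using l(4)[of i] by (cases "l = i") auto
  qed
qed simp

text \<open>Finite record times are at most \<open>i\<close> and at least their own index, so their
  indices are at most \<open>i\<close>. The bound \<open>Suc i\<close> leaves room for the one
  further index where the record time is defined but infinite.\<close>

lemma finite_record_times:
  assumes "i \<ge> 1" and "\<And>j. j \<ge> 1 \<Longrightarrow> x j \<le> x i"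
  shows "finite {n. n \<ge> 1 \<and> record_time x n \<noteq> None}"
proof (rule finite_subset)
  show "{n. n \<ge> 1 \<and> record_time x n \<noteq> None} \<subseteq> {..Suc i}"
  proof safe
    fix n u assume n: "n \<ge> 1" "record_time x n = Some u"
    show "n \<le> Suc i"
    proof (cases "n = 1")
      case False
      then obtain m where m: "n = Suc (Suc m)" using n(1) by (metis One_nat_def not0_implies_Suc not_one_le_zero)
      then obtain k where "record_time x (Suc m) = Some (enat k)"
        using n(2) by (auto split: option.splits enat.splits)
      then show ?thesis
        using record_time_ge_index record_time_le_argmax[where x = x, OF assms] m by fastforce
    qed simp
  qed
qed simp

lemma infinite_records:
  assumes "\<And>i. i \<ge> 1 \<Longrightarrow> \<exists>j>i. x i < x j"
  shows "infinite {n. n \<ge> 1 \<and> record_value x n \<noteq> None}"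
proof -
  have "record_value x n \<noteq> None" if "n \<ge> 1" for n
    using record_time_finite[OF assms, of "n - 1"] that by (auto simp: record_value_def)
  then have "{n. n \<ge> 1 \<and> record_value x n \<noteq> None} = {1..}" by auto
  then show ?thesis by (simp add: infinite_Ici)
qed

lemma record_time_two_infinite_iff:
  "record_time x 2 = Some \<infinity> \<longleftrightarrow> (\<forall>j>1. x j \<le> x 1)"
proof -
  have "record_time x 2 = Some (Inf (enat ` {j. j > 1 \<and> x j > x 1}))"
    by (simp add: numeral_2_eq_2 one_enat_def)
  moreover have "Inf (enat ` S) = \<infinity> \<longleftrightarrow> S = {}" for S
    by (metis Inf_enat_image_mem enat.distinct(1) image_empty Inf_empty top_enat_def)
  ultimately have "record_time x 2 = Some \<infinity> \<longleftrightarrow> {j. j > 1 \<and> x j > x 1} = {}" by simp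
  then show ?thesis by (auto intro: leI)
qed

text \<open>Once a record time is infinite, all later ones are \<open>None\<close>, so a finite one
  rules out that the sequence stopped at the second.\<close>

lemma record_time_two_not_infinite:
  assumes "record_time x (Suc (Suc n)) = Some (enat k)"
  shows "record_time x 2 \<noteq> Some \<infinity>"
  using assms
proof (induction n arbitrary: k)
  case (Suc n)
  then show ?case by (metis record_time_Suc_enatD)
qed (simp add: numeral_2_eq_2)

section \<open>The upper endpoint and the almost sure behaviour of an iid sequence\<close>

lemma cdf_lt_1_if_less_uep:
  assumes "real_distribution D" and "ereal q < uep (cdf D)"
  shows "cdf D q < 1"
proof -
  interpret real_distribution D by fact
  obtain y where "cdf D y < 1" "q < y"
    using assms(2) unfolding uep_def less_Sup_iff by auto
  then show ?thesis using cdf_nondecreasing[of q y] by simp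
qed

lemma cdf_eq_1_if_uep_less:
  assumes "real_distribution D" and "uep (cdf D) < ereal q"
  shows "cdf D q = 1"
proof (rule ccontr)
  interpret real_distribution D by fact
  assume "cdf D q \<noteq> 1"
  then have "cdf D q < 1" using cdf_bounded_prob[of q] by simp
  then have "ereal q \<le> uep (cdf D)" unfolding uep_def by (intro Sup_upper) auto
  then show False using assms(2) by simp
qed

text \<open>With \<open>p\<close> the mass of \<open>B\<close>, independence gives probability
  \<open>(1 - p) ^ Suc r\<close> to missing \<open>B\<close> at \<open>Suc r\<close> consecutive
  indices, and this tends to 0 as \<open>r\<close> grows.\<close>

lemma (in prob_space) AE_iid_infinitely_often:
  fixes m :: nat
  assumes indep: "indep_vars (\<lambda>_. N) Xs {m..}"
    and distr: "\<And>i. i \<ge> m \<Longrightarrow> distr M N (Xs i) = D"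
    and B: "B \<in> sets N" "measure D B > 0"
  shows "AE \<omega> in M. \<exists>j>i. Xs j \<omega> \<in> B"
proof -
  have rv: "Xs j \<in> measurable M N" if "j \<ge> m" for j
    using indep that by (auto simp: indep_vars_def)
  have D: "prob (Xs j -` A \<inter> space M) = measure D A" if "j \<ge> m" "A \<in> sets N" for j A
    using measure_distr[OF rv that(2)] distr that(1) by metis
  have spaceD: "space D = space N" and setsD: "sets D = sets N"
    using distr[OF order_refl] by auto
  interpret D: prob_space D
    using prob_space_distr[OF rv[of m]] distr[OF order_refl] by simp
  define p where "p = measure D B"
  \<comment> \<open>Independence and the common law are available only from index \<open>m\<close>
    on, so the search for a hit starts after both \<open>i\<close> and \<open>m\<close>.\<close>
  define l where "l = max i m"
  define A where "A = {\<omega>\<in>space M. \<forall>j>l. Xs j \<omega> \<in> space N - B}"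
  have meas: "A \<in> events"
  proof -
    have "A = (\<Inter>j\<in>{l<..}. Xs j -` (space N - B) \<inter> space M)"
      unfolding A_def by (auto simp: greaterThan_def)
    also have "\<dots> \<in> events"
      using B(1) by (intro sets.countable_INT' measurable_sets[OF rv])
        (auto simp: l_def intro!: measurable_sets[OF rv])
    finally show ?thesis .
  qed
  have le: "prob A \<le> (1 - p) ^ Suc r" for r
  proof -
    have J: "{l<..l + Suc r} \<subseteq> {m..}" by (auto simp: l_def)
    have "prob A \<le> prob (\<Inter>j\<in>{l<..l + Suc r}. Xs j -` (space N - B) \<inter> space M)"
      using B(1) by (intro finite_measure_mono sets.finite_INT measurable_sets[OF rv])
        (auto simp: A_def l_def)
    also have "\<dots> = (\<Prod>j\<in>{l<..l + Suc r}. prob (Xs j -` (space N - B) \<inter> space M))"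
      using B(1) by (intro indep_varsD[OF indep _ _ J]) auto
    also have "\<dots> = (\<Prod>j\<in>{l<..l + Suc r}. 1 - p)"
      using J B(1) D.prob_compl[of B] by (intro prod.cong) (auto simp: D p_def spaceD setsD)
    finally show ?thesis by simp
  qed
  have "(\<lambda>r. (1 - p) ^ Suc r) \<longlonglongrightarrow> 0"
    using B(2) D.prob_le_1[of B] by (intro LIMSEQ_Suc LIMSEQ_power_zero) (auto simp: p_def)
  then have "prob A \<le> 0" using le by (intro LIMSEQ_le_const) auto
  then have "AE \<omega> in M. \<omega> \<notin> A"
    using prob_eq_0[OF meas] measure_nonneg[of M A] by simp
  then show ?thesis
  proof (rule AE_mp, intro AE_I2 impI)
    fix \<omega> assume \<omega>: "\<omega> \<in> space M" "\<omega> \<notin> A"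
    then obtain j where j: "j > l" "Xs j \<omega> \<notin> space N - B" by (auto simp: A_def)
    moreover have "Xs j \<omega> \<in> space N"
      using measurable_space[OF rv \<omega>(1)] j(1) by (simp add: l_def)
    ultimately show "\<exists>j>i. Xs j \<omega> \<in> B" by (auto simp: l_def)
  qed
qed

text \<open>Each level above the endpoint is exceeded with probability 0. Restricting to rational
  levels leaves countably many null sets, and density of the rationals recovers the bound.\<close>

lemma AE_le_uep:
  assumes "real_distribution D"
  shows "AE x in D. ereal x \<le> uep (cdf D)"
proof -
  interpret real_distribution D by fact
  have "AE x in D. uep (cdf D) < ereal q \<longrightarrow> x \<le> q" for q
  proof (cases "uep (cdf D) < ereal q")
    case True
    then have "prob {..q} = 1" using cdf_eq_1_if_uep_less[OF assms] by (simp add: cdf_def)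
    then show ?thesis using prob_eq_1[of "{..q}"] by simp
  qed simp
  then have "AE x in D. \<forall>r::rat. uep (cdf D) < ereal (real_of_rat r) \<longrightarrow> x \<le> real_of_rat r"
    by (simp add: AE_all_countable)
  then show ?thesis
  proof (rule AE_mp, intro AE_I2 impI)
    fix x assume *: "\<forall>r::rat. uep (cdf D) < ereal (real_of_rat r) \<longrightarrow> x \<le> real_of_rat r"
    show "ereal x \<le> uep (cdf D)"
    proof (rule ccontr)
      assume "\<not> ereal x \<le> uep (cdf D)"
      then show False using * ereal_dense3[of "uep (cdf D)" "ereal x"] by force
    qed
  qed
qed

text \<open>The level \<open>Xs i \<omega>\<close> is random, whereas
  \<open>AE_iid_infinitely_often\<close> treats a fixed set. A rational strictly between this level
  and the endpoint reduces the claim to countably many fixed half-lines.\<close>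

lemma (in prob_space) AE_iid_exceeds_below_uep:
  fixes m :: nat
  assumes indep: "indep_vars (\<lambda>_. borel) Xs {m..}"
    and distr: "\<And>i. i \<ge> m \<Longrightarrow> distr M borel (Xs i) = D"
  shows "AE \<omega> in M. \<forall>i. ereal (Xs i \<omega>) < uep (cdf D) \<longrightarrow> (\<exists>j>i. Xs i \<omega> < Xs j \<omega>)"
proof -
  have "Xs m \<in> borel_measurable M" using indep by (simp add: indep_vars_def)
  then have D: "real_distribution D"
    using real_distribution_distr[of "Xs m"] distr[OF order_refl] by simp
  then interpret D: real_distribution D .
  have "AE \<omega> in M. ereal q < uep (cdf D) \<longrightarrow> (\<exists>j>i. Xs j \<omega> \<in> {q<..})" for q and i :: nat
  proof (cases "ereal q < uep (cdf D)")
    case True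
    have "UNIV - {..q} = {q<..}" by auto
    then have "measure D {q<..} > 0"
      using cdf_lt_1_if_less_uep[OF D True] D.prob_compl[of "{..q}"] by (simp add: cdf_def)
    then show ?thesis
      using AE_iid_infinitely_often[OF indep distr, where B = "{q<..}" and i = i] by simp
  qed simp
  then have "AE \<omega> in M. \<forall>i. \<forall>r::rat. ereal (real_of_rat r) < uep (cdf D) \<longrightarrow>
      (\<exists>j>i. Xs j \<omega> \<in> {real_of_rat r<..})"
    by (simp add: AE_all_countable)
  then show ?thesis
  proof (rule AE_mp, intro AE_I2 impI allI)
    fix \<omega> i
    assume *: "\<forall>i. \<forall>r::rat. ereal (real_of_rat r) < uep (cdf D) \<longrightarrow>
        (\<exists>j>i. Xs j \<omega> \<in> {real_of_rat r<..})"
      and "ereal (Xs i \<omega>) < uep (cdf D)"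
    then obtain r :: rat where "ereal (Xs i \<omega>) < ereal (real_of_rat r)"
      "ereal (real_of_rat r) < uep (cdf D)"
      using ereal_dense3 by blast
    then show "\<exists>j>i. Xs i \<omega> < Xs j \<omega>" using *
      by (metis ereal_less(1) greaterThan_iff less_ereal.simps(1) order.strict_trans)
  qed
qed

section \<open>Probability of a last record and finiteness of the record sequence\<close>

theorem proposition3:
  fixes M :: "'a measure"
    and X :: "'a \<Rightarrow> real"
    and Xs :: "nat \<Rightarrow> 'a \<Rightarrow> real"
    and F :: "real \<Rightarrow> real"
  assumes "prob_space M"
    and "X \<in> borel_measurable M"
    and "prob_space.indep_vars M (\<lambda>_. borel) Xs {1..}"
    and "\<And>i. i \<ge> 1 \<Longrightarrow> distr M borel (Xs i) = distr M borel X"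
    and "F = cdf (distr M borel X)"
  shows "(\<forall>n\<ge>1. (AE \<omega> in M. \<exists>k. record_time (\<lambda>i. Xs i \<omega>) n = Some (enat k)) \<longrightarrow>
            measure M {\<omega> \<in> space M. record_time (\<lambda>i. Xs i \<omega>) (n + 1) = Some \<infinity>}
              = measure M {\<omega> \<in> space M. ereal (X \<omega>) = uep F})
       \<and> ((AE \<omega> in M. finite {n. n \<ge> 1 \<and> record_value (\<lambda>i. Xs i \<omega>) n \<noteq> None})
            \<longleftrightarrow> \<bar>uep F\<bar> \<noteq> \<infinity> \<and> measure M {\<omega> \<in> space M. ereal (X \<omega>) = uep F} > 0)
       \<and> ((AE \<omega> in M. finite {n. n \<ge> 1 \<and> record_time (\<lambda>i. Xs i \<omega>) n \<noteq> None})
            \<longleftrightarrow> \<bar>uep F\<bar> \<noteq> \<infinity> \<and> measure M {\<omega> \<in> space M. ereal (X \<omega>) = uep F} > 0)"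
proof -
  interpret prob_space M by fact
  note indep = assms(3)
  define D where "D = distr M borel X"
  \<comment> \<open>As a set of reals, \<open>B\<close> is a singleton if the endpoint is finite and
    empty otherwise, so both situations are handled uniformly.\<close>
  define B where "B = {x. ereal x = uep F}"
  have D: "real_distribution D" using assms(2) unfolding D_def by simp
  then interpret D: real_distribution D .
  have F: "F = cdf D" by (simp add: D_def assms(5))
  have distr: "distr M borel (Xs i) = D" if "i \<ge> 1" for i
    using assms(4) that by (simp add: D_def)
  have rv[measurable]: "Xs i \<in> borel_measurable M" if "i \<ge> 1" for i
    using indep that by (auto simp: indep_vars_def)
  have [measurable]: "B \<in> sets borel" unfolding B_def by measurable
  let ?p = "measure M {\<omega> \<in> space M. ereal (X \<omega>) = uep F}"
  have p: "?p = measure D B"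
    unfolding D_def using assms(2)
    by (subst measure_distr) (auto simp: B_def intro!: arg_cong[of _ _ "measure M"])
  have pi: "measure M {\<omega> \<in> space M. Xs i \<omega> \<in> B} = ?p" if "i \<ge> 1" for i
    unfolding p distr[OF that, symmetric] using rv[OF that]
    by (subst measure_distr) (auto intro!: arg_cong[of _ _ "measure M"])
  have AE_notin: "(AE \<omega> in M. Xs i \<omega> \<notin> B) \<longleftrightarrow> ?p = 0" if "i \<ge> 1" for i
    using prob_eq_0[of "{\<omega> \<in> space M. Xs i \<omega> \<in> B}"] pi[OF that] rv[OF that] by auto
  have "AE \<omega> in M. ereal (Xs i \<omega>) \<le> uep F" if "i \<ge> 1" for i
    by (rule AE_distrD[OF rv[OF that]]) (unfold distr[OF that] F, rule AE_le_uep[OF D])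
  then have le: "AE \<omega> in M. \<forall>i\<in>{1..}. ereal (Xs i \<omega>) \<le> uep F"
    by (subst AE_ball_countable) auto
  have less: "AE \<omega> in M. \<forall>i. ereal (Xs i \<omega>) < uep F \<longrightarrow> (\<exists>j>i. Xs i \<omega> < Xs j \<omega>)"
    using AE_iid_exceeds_below_uep[OF indep distr] F by simp

  have no_atom: "AE \<omega> in M. \<forall>i\<ge>1. \<exists>j>i. Xs i \<omega> < Xs j \<omega>" if "?p = 0"
  proof -
    have "AE \<omega> in M. \<forall>i\<in>{1..}. Xs i \<omega> \<notin> B"
      using AE_notin that by (subst AE_ball_countable) auto
    then show ?thesis using le less
      by eventually_elim (auto simp: B_def order.order_iff_strict)
  qed
  have atom: "AE \<omega> in M. \<exists>i\<ge>1. \<forall>j\<ge>1. Xs j \<omega> \<le> Xs i \<omega>" if "?p > 0"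
  proof -
    \<comment> \<open>The hitting lemma at \<open>i = 0\<close> yields a legitimate index, at least
      1; by \<open>le\<close>, a hit of the endpoint is a global maximum.\<close>
    have "AE \<omega> in M. \<exists>j>0. Xs j \<omega> \<in> B"
      using AE_iid_infinitely_often[OF indep distr] that p by simp
    then show ?thesis using le
    proof eventually_elim
      case (elim \<omega>)
      then obtain i where i: "i > 0" "ereal (Xs i \<omega>) = uep F" by (auto simp: B_def)
      have "Xs j \<omega> \<le> Xs i \<omega>" if "j \<ge> 1" for j
        using elim(2) that unfolding i(2)[symmetric] by auto
      then show ?case using i(1) by (intro exI[of _ i]) auto
    qed
  qed

  \<comment> \<open>Below the endpoint the first entry is exceeded later by \<open>less\<close>; at
    the endpoint \<open>le\<close> forbids this.\<close>
  have U2: "AE \<omega> in M. record_time (\<lambda>i. Xs i \<omega>) 2 = Some \<infinity> \<longleftrightarrow> Xs 1 \<omega> \<in> B"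
    using le less
  proof eventually_elim
    case (elim \<omega>)
    show ?case unfolding record_time_two_infinite_iff
    proof
      assume "\<forall>j>1. Xs j \<omega> \<le> Xs 1 \<omega>"
      then have "\<not> ereal (Xs 1 \<omega>) < uep F" using elim(2) by (meson leD)
      then show "Xs 1 \<omega> \<in> B" using elim(1) by (auto simp: B_def order.order_iff_strict)
    next
      assume "Xs 1 \<omega> \<in> B"
      then have e: "ereal (Xs 1 \<omega>) = uep F" by (simp add: B_def)
      show "\<forall>j>1. Xs j \<omega> \<le> Xs 1 \<omega>"
        using elim(1) unfolding e[symmetric] by auto
    qed
  qed

  have part1: "measure M {\<omega> \<in> space M. record_time (\<lambda>i. Xs i \<omega>) (n + 1) = Some \<infinity>} = ?p"
    if n: "n \<ge> 1" and fin: "AE \<omega> in M. \<exists>k. record_time (\<lambda>i. Xs i \<omega>) n = Some (enat k)" for n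
  proof (cases "n = 1")
    case True
    \<comment> \<open>Writing the event as a countable intersection shows its measurability, which
      \<open>measure_eq_AE\<close> requires.\<close>
    have "{\<omega> \<in> space M. record_time (\<lambda>i. Xs i \<omega>) 2 = Some \<infinity>}
        = (\<Inter>j\<in>{1<..}. {\<omega> \<in> space M. Xs j \<omega> \<le> Xs 1 \<omega>})"
      by (auto simp: record_time_two_infinite_iff greaterThan_def)
    also have "\<dots> \<in> events"
      by (intro sets.countable_INT') (auto intro!: borel_measurable_le rv)
    finally have "measure M {\<omega> \<in> space M. record_time (\<lambda>i. Xs i \<omega>) 2 = Some \<infinity>}
        = measure M {\<omega> \<in> space M. Xs 1 \<omega> \<in> B}"
      using U2 by (intro measure_eq_AE) auto
    then show ?thesis using pi[of 1] True by (simp add: numeral_2_eq_2)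
  next
    case False
    then obtain m where m: "n = Suc (Suc m)" using n by (metis One_nat_def not0_implies_Suc not_one_le_zero)
    \<comment> \<open>For \<open>n\<close> at least 2 both sides of the claim turn out to be 0: the
      finiteness assumption excludes an infinite second record time, hence an atom at the
      endpoint.\<close>
    have "AE \<omega> in M. Xs 1 \<omega> \<notin> B"
      using fin U2 by eventually_elim (use record_time_two_not_infinite m in blast)
    then have "?p = 0" using AE_notin[of 1] by simp
    have "AE \<omega> in M. record_time (\<lambda>i. Xs i \<omega>) (n + 1) \<noteq> Some \<infinity>"
      using no_atom[OF \<open>?p = 0\<close>]
    proof eventually_elim
      case (elim \<omega>)
      then show ?case using record_time_finite[of "\<lambda>i. Xs i \<omega>" n] by auto
    qed
    then have "AE \<omega> in M. \<omega> \<notin> {\<omega> \<in> space M. record_time (\<lambda>i. Xs i \<omega>) (n + 1) = Some \<infinity>}"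
      by eventually_elim simp
    \<comment> \<open>a non-measurable set has measure 0 by convention\<close>
    then have "measure M {\<omega> \<in> space M. record_time (\<lambda>i. Xs i \<omega>) (n + 1) = Some \<infinity>} = 0"
      using prob_eq_0 measure_notin_sets by blast
    then show ?thesis using \<open>?p = 0\<close> by simp
  qed

  \<comment> \<open>A real-valued \<open>X\<close> never equals an infinite endpoint, so in that
    case the event is empty.\<close>
  have uep_fin: "\<bar>uep F\<bar> \<noteq> \<infinity>" if "?p > 0"
  proof
    assume "\<bar>uep F\<bar> = \<infinity>"
    then have no: "{\<omega> \<in> space M. ereal (X \<omega>) = uep F} = {}" by auto
    show False using that unfolding no by simp
  qed
  \<comment> \<open>The predicate \<open>P\<close> stands for finiteness of either the record values
    or the record times. The hypothesis \<open>stop\<close> uses the larger index set and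
    \<open>go_on\<close> the smaller one, so by \<open>mono\<close> both hold for either
    choice.\<close>
  have finite_iff: "(AE \<omega> in M. P \<omega>) \<longleftrightarrow> \<bar>uep F\<bar> \<noteq> \<infinity> \<and> ?p > 0"
    if stop: "\<And>\<omega>. finite {n. n \<ge> 1 \<and> record_time (\<lambda>i. Xs i \<omega>) n \<noteq> None} \<Longrightarrow> P \<omega>"
      and go_on: "\<And>\<omega>. infinite {n. n \<ge> 1 \<and> record_value (\<lambda>i. Xs i \<omega>) n \<noteq> None} \<Longrightarrow> \<not> P \<omega>"
    for P
  proof (cases "?p > 0")
    case True
    have "AE \<omega> in M. P \<omega>"
      using atom[OF True]
    proof eventually_elim
      case (elim \<omega>)
      then obtain i where i: "i \<ge> 1" "\<And>j. j \<ge> 1 \<Longrightarrow> Xs j \<omega> \<le> Xs i \<omega>" by blast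
      show ?case by (rule stop, rule finite_record_times[where x = "\<lambda>i. Xs i \<omega>", OF i])
    qed
    then show ?thesis using uep_fin True by simp
  next
    case False
    then have "?p = 0" using zero_less_measure_iff by metis
    have "AE \<omega> in M. \<not> P \<omega>"
      using no_atom[OF \<open>?p = 0\<close>]
    proof eventually_elim
      case (elim \<omega>)
      then show ?case by (intro go_on infinite_records) blast
    qed
    \<comment> \<open>In a probability space \<open>P\<close> and its negation cannot both hold
      almost everywhere.\<close>
    then have "\<not> (AE \<omega> in M. P \<omega>)"
      using AE_conj_iff[of P "\<lambda>\<omega>. \<not> P \<omega>" M] by auto
    then show ?thesis using False by simp
  qed
  have mono: "finite {n. n \<ge> 1 \<and> record_time x n \<noteq> None} \<Longrightarrow>
      finite {n. n \<ge> 1 \<and> record_value x n \<noteq> None}" for x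
    by (erule rev_finite_subset) (auto simp: record_value_def split: option.splits)
  show ?thesis
  proof (intro conjI allI impI)
    show "(AE \<omega> in M. finite {n. n \<ge> 1 \<and> record_value (\<lambda>i. Xs i \<omega>) n \<noteq> None})
        \<longleftrightarrow> \<bar>uep F\<bar> \<noteq> \<infinity> \<and> ?p > 0"
      by (rule finite_iff) (rule mono)
    show "(AE \<omega> in M. finite {n. n \<ge> 1 \<and> record_time (\<lambda>i. Xs i \<omega>) n \<noteq> None})
        \<longleftrightarrow> \<bar>uep F\<bar> \<noteq> \<infinity> \<and> ?p > 0"
      by (rule finite_iff) (use mono in blast)+
  qed (rule part1)
qed

end
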